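(* Assume that the singular values satisfy the polynomial spectral decay condition $C_A^{-1}i^{-p}\le\lambda_i\le C_Ai^{-p}$, $i=1,\dots,D$, and that $\kappa\ge\sum_{i=1}^D\lambda_i^{2\alpha}\delta^2$. Then there exists a constant $C_A'>0$ depending on $p$ and $C_A$ such that $$\sup_{\mu\in H^\beta(r,D)}\mathbb{E}\|\widehat{\mu}^{(\tau_\alpha)}-\mu\|^2\ge C_A'\,\mathcal{R}_{\beta,r,p,\alpha}(\delta)$$ with $$\mathcal{R}_{\beta,r,p,\alpha}(\delta)=\begin{cases}r^2\big(r^{-2}\delta^2/(1-2\alpha p)\big)^{2\beta/(2\beta+2p+1)},&\alpha p<1/2,\\ r^2\big(r^{-2}\delta^2\log(r^2\delta^{-2})\big)^{2\beta/(2\beta+2p+1)},&\alpha p=1/2,\\ r^2\big(r^{-2}\delta^2\big)^{2\beta/(2\beta+2p+2\alpha p)},&\alpha p>1/2,\end{cases}$$ provided that $\delta$ is sufficiently small and $t^{mm}_{\beta,p,r}(\delta)=o(D)$.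
   Context: Model: one observes $Y_i=\lambda_i\mu_i+\delta\varepsilon_i$, $i=1,\dots,D$, where $\varepsilon_1,\dots,\varepsilon_D$ are independent standard Gaussian random variables, $\delta>0$ is the noise level, $\mu=(\mu_i)_{i\le D}\in\mathbb{R}^D$ is the unknown signal and $1\ge\lambda_1\ge\dots\ge\lambda_D>0$ are the singular values of the operator. $\|\cdot\|$ is the Euclidean norm. The dimension $D=D(\delta)$ may depend on $\delta$, and $t^{mm}_{\beta,p,r}(\delta)=o(D)$ is understood as $\delta\to 0$. Parameters: $p\ge 0$ and $C_A\ge 1$ are the constants of the spectral decay condition, $\kappa>0$ is the critical value, and $\alpha\ge 0$ is the smoothing index; all smoothing indices are assumed to be bounded from above by some $\bar\alpha>0$. Estimators: for integers $0\le m\le D$, $\widehat{\mu}^{(m)}_i=\mathbf{1}\{i\le m\}\lambda_i^{-1}Y_i$, $i=1,\dots,D$. Stopping time: $R^2_{m,\alpha}=\sum_{i=m+1}^D\lambda_i^{2\alpha}Y_i^2$ and $\tau_\alpha=\inf\{m\in\mathbb{N}\cup\{0\}:R^2_{m,\alpha}\le\kappa\}$. Sobolev-type ellipsoids: for $\beta\ge 0$ and $r>0$, $H^\beta(r,D)=\{\mu\in\mathbb{R}^D:\sum_{i=1}^Di^{2\beta}\mu_i^2\le r^2\}$. Minimax truncation index: $t^{mm}_{\beta,p,r}(\delta)=(r^2\delta^{-2})^{1/(2\beta+2p+1)}$.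
   Formalization: The constant also depends on the standing bound on the smoothing indices and, when αp = 1/2, on an arbitrary upper bound for β; uniformity in β fails there (λ_i = i^{-1/2}, α = 1, β → ∞). All β ≥ 0 remain covered. *)

theory Defs
  imports "HOL-Probability.Probability" "HOL-Library.Landau_Symbols"
begin

text \<open>
  Vectors of \<open>\<real>\<^sup>D\<close> are functions \<open>nat \<Rightarrow> real\<close> of which only the components with index in
  \<open>{1..D}\<close> matter. In the definitions below \<open>lam\<close> are the singular values, \<open>Y\<close> the data,
  \<open>delta\<close> the noise level and \<open>e\<close> a realisation of the noise vector.
\<close>

definition std_gaussian_noise :: "'a measure \<Rightarrow> (nat \<Rightarrow> 'a \<Rightarrow> real) \<Rightarrow> nat \<Rightarrow> bool" where
  "std_gaussian_noise M eps D \<longleftrightarrow>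
     prob_space M \<and>
     prob_space.indep_vars M (\<lambda>_. borel) eps {1..D} \<and>
     (\<forall>i\<in>{1..D}. distributed M lborel (eps i) (\<lambda>x. ennreal (std_normal_density x)))"

definition singular_values :: "(nat \<Rightarrow> real) \<Rightarrow> nat \<Rightarrow> bool" where
  "singular_values lam D \<longleftrightarrow>
     (\<forall>i\<in>{1..D}. 0 < lam i \<and> lam i \<le> 1) \<and>
     (\<forall>i\<in>{1..D}. \<forall>j\<in>{1..D}. i \<le> j \<longrightarrow> lam j \<le> lam i)"

definition poly_spectral_decay :: "real \<Rightarrow> real \<Rightarrow> (nat \<Rightarrow> real) \<Rightarrow> nat \<Rightarrow> bool" where
  "poly_spectral_decay p C_A lam D \<longleftrightarrow>
     (\<forall>i\<in>{1..D}. inverse C_A * real i powr (- p) \<le> lam i \<and> lam i \<le> C_A * real i powr (- p))"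

definition observation ::
  "(nat \<Rightarrow> real) \<Rightarrow> (nat \<Rightarrow> real) \<Rightarrow> real \<Rightarrow> (nat \<Rightarrow> real) \<Rightarrow> nat \<Rightarrow> real" where
  "observation lam mu delta e i = lam i * mu i + delta * e i"

definition svd_estimator :: "(nat \<Rightarrow> real) \<Rightarrow> (nat \<Rightarrow> real) \<Rightarrow> nat \<Rightarrow> nat \<Rightarrow> real" where
  "svd_estimator lam Y m i = (if i \<le> m then inverse (lam i) * Y i else 0)"

definition smoothed_residual ::
  "(nat \<Rightarrow> real) \<Rightarrow> nat \<Rightarrow> real \<Rightarrow> (nat \<Rightarrow> real) \<Rightarrow> nat \<Rightarrow> real" where
  "smoothed_residual lam D alpha Y m = (\<Sum>i=m+1..D. lam i powr (2 * alpha) * (Y i)\<^sup>2)"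

text \<open>
  For \<open>kappa \<ge> 0\<close> the set contains \<open>D\<close>, so its infimum is its least element, and \<open>tau \<le> D\<close>.
\<close>
definition stopping_time ::
  "(nat \<Rightarrow> real) \<Rightarrow> nat \<Rightarrow> real \<Rightarrow> real \<Rightarrow> (nat \<Rightarrow> real) \<Rightarrow> nat" where
  "stopping_time lam D alpha kappa Y = Inf {m. smoothed_residual lam D alpha Y m \<le> kappa}"

definition sq_norm :: "nat \<Rightarrow> (nat \<Rightarrow> real) \<Rightarrow> real" where
  "sq_norm D v = (\<Sum>i=1..D. (v i)\<^sup>2)"

text \<open>
  The expectation of the squared loss is taken as a Lebesgue integral with values in
  \<open>[0, \<infinity>]\<close>, and hence so is its supremum over a set of signals.
\<close>
definition stopped_risk ::
  "'a measure \<Rightarrow> (nat \<Rightarrow> 'a \<Rightarrow> real) \<Rightarrow> (nat \<Rightarrow> real) \<Rightarrow> nat \<Rightarrow> real \<Rightarrow> real \<Rightarrow> real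
     \<Rightarrow> (nat \<Rightarrow> real) \<Rightarrow> ennreal" where
  "stopped_risk M eps lam D delta alpha kappa mu =
     (\<integral>\<^sup>+ \<omega>. ennreal (let Y = observation lam mu delta (\<lambda>i. eps i \<omega>);
                         tau = stopping_time lam D alpha kappa Y
                     in sq_norm D (\<lambda>i. svd_estimator lam Y tau i - mu i)) \<partial>M)"

definition sobolev_ellipsoid :: "real \<Rightarrow> real \<Rightarrow> nat \<Rightarrow> (nat \<Rightarrow> real) set" where
  "sobolev_ellipsoid beta r D = {mu. (\<Sum>i=1..D. real i powr (2 * beta) * (mu i)\<^sup>2) \<le> r\<^sup>2}"

definition minimax_index :: "real \<Rightarrow> real \<Rightarrow> real \<Rightarrow> real \<Rightarrow> real" where
  "minimax_index beta p r delta = (r\<^sup>2 / delta\<^sup>2) powr (1 / (2 * beta + 2 * p + 1))"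

definition rate :: "real \<Rightarrow> real \<Rightarrow> real \<Rightarrow> real \<Rightarrow> real \<Rightarrow> real" where
  "rate beta r p alpha delta =
     (if alpha * p < 1 / 2 then
        r\<^sup>2 * (delta\<^sup>2 / r\<^sup>2 / (1 - 2 * alpha * p)) powr (2 * beta / (2 * beta + 2 * p + 1))
      else if alpha * p = 1 / 2 then
        r\<^sup>2 * (delta\<^sup>2 / r\<^sup>2 * ln (r\<^sup>2 / delta\<^sup>2)) powr (2 * beta / (2 * beta + 2 * p + 1))
      else
        r\<^sup>2 * (delta\<^sup>2 / r\<^sup>2) powr (2 * beta / (2 * beta + 2 * p + 2 * alpha * p)))"

end

theory Submission
  imports Defs "HOL-Real_Asymp.Real_Asymp"
begin

text \<open>
  The procedure misses a signal that is hidden by the noise in its residual. The noise part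
  \<open>\<delta>\<^sup>2 \<Sum>i>m. \<lambda>\<^sub>i powr (2\<alpha>) \<epsilon>\<^sub>i\<^sup>2\<close> of the residual at \<open>m\<close> has mean \<open>\<delta>\<^sup>2 \<Sum>i>m. \<lambda>\<^sub>i powr (2\<alpha>)\<close>, whereas the critical value is at
  least \<open>\<delta>\<^sup>2 \<Sum>i\<le>D. \<lambda>\<^sub>i powr (2\<alpha>)\<close>. Take a signal with a single nonzero coordinate \<open>n\<close>, of the maximal
  size \<open>r n powr (- \<beta>)\<close> that the ellipsoid admits. If its contribution
  \<open>\<lambda>\<^sub>n powr (2\<alpha> + 2) r\<^sup>2 n powr (- 2\<beta>)\<close> to the residual is small compared with the surplus
  \<open>\<delta>\<^sup>2 \<Sum>i\<le>n. \<lambda>\<^sub>i powr (2\<alpha>)\<close> in the critical value, then the procedure stops before \<open>n\<close> with a probability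
  bounded away from zero and incurs a loss of at least \<open>r\<^sup>2 n powr (- 2\<beta>)\<close>
  (\<open>spike_residual_le_noise_budget\<close>, \<open>sup_stopped_risk_lower_bound\<close>).

  The probabilistic difficulty is that \<open>D\<close> can be arbitrarily large compared with \<open>n\<close>, so that the
  fluctuations of the residual may exceed the surplus by far and no concentration inequality helps.
  One needs that a weighted sum of squared Gaussians is at most its mean with a probability bounded
  from below uniformly in the weights (\<open>prob_weighted_chi_square_le_mean\<close>); the explicit Laplace
  transform of \<open>\<epsilon>\<^sub>i\<^sup>2\<close> and a second-moment argument give this.

  Under polynomial decay the condition on \<open>n\<close> becomes
  \<open>n powr (2\<beta> + 2p + 2\<alpha>p) \<Sum>i\<le>n. i powr (- 2\<alpha>p) \<ge> K r\<^sup>2 / \<delta>\<^sup>2\<close>. The smallest such \<open>n\<close> yields the rate, and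
  the sum produces its three regimes (\<open>rate_index_asymptotics\<close>, \<open>eventually_truncation_index\<close>). The
  assumption that the minimax index is of smaller order than \<open>D\<close> ensures that \<open>n \<le> D\<close>.
\<close>

section \<open>Weighted sums of squared Gaussians\<close>

lemma nn_integral_exp_neg_std_normal_square:
  fixes a :: real
  assumes X: "distributed M lborel X (\<lambda>x. ennreal (std_normal_density x))" and a: "0 \<le> a"
  shows "(\<integral>\<^sup>+\<omega>. ennreal (exp (- a * (X \<omega>)\<^sup>2)) \<partial>M) = ennreal (1 / sqrt (1 + 2 * a))"
proof -
  define v where "v = 1 + 2 * a"
  define s where "s = 1 / sqrt v"
  have v: "v > 0" using a by (simp add: v_def)
  have s: "s > 0" "s\<^sup>2 = 1 / v" using v by (auto simp: s_def power_divide)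
  have dens: "std_normal_density x * exp (- a * x\<^sup>2) = s * normal_density 0 s x" for x
  proof -
    have "- x\<^sup>2 / 2 + (- a * x\<^sup>2) = - (x - 0)\<^sup>2 / (2 * s\<^sup>2)"
      unfolding s v_def using v by (simp add: field_simps v_def)
    hence "exp (- x\<^sup>2 / 2) * exp (- a * x\<^sup>2) = exp (- (x - 0)\<^sup>2 / (2 * s\<^sup>2))"
      by (simp flip: exp_add)
    moreover have "1 / sqrt (2 * pi) = s * (1 / sqrt (2 * pi * s\<^sup>2))"
      using s(1) by (simp add: real_sqrt_mult)
    ultimately show ?thesis
      unfolding normal_density_def by (simp add: algebra_simps)
  qed
  have "(\<integral>\<^sup>+\<omega>. ennreal (exp (- a * (X \<omega>)\<^sup>2)) \<partial>M)
      = (\<integral>\<^sup>+x. ennreal (std_normal_density x) * ennreal (exp (- a * x\<^sup>2)) \<partial>lborel)"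
    by (subst distributed_nn_integral[OF X]) auto
  also have "\<dots> = (\<integral>\<^sup>+x. ennreal s * ennreal (normal_density 0 s x) \<partial>lborel)"
  proof (intro nn_integral_cong)
    fix x
    have "ennreal (std_normal_density x) * ennreal (exp (- a * x\<^sup>2))
        = ennreal (std_normal_density x * exp (- a * x\<^sup>2))"
      by (simp add: ennreal_mult')
    also have "\<dots> = ennreal s * ennreal (normal_density 0 s x)"
      unfolding dens using s(1) by (simp add: ennreal_mult')
    finally show "ennreal (std_normal_density x) * ennreal (exp (- a * x\<^sup>2))
        = ennreal s * ennreal (normal_density 0 s x)" .
  qed
  also have "\<dots> = ennreal s * (\<integral>\<^sup>+x. ennreal (normal_density 0 s x) \<partial>lborel)"
    by (intro nn_integral_cmult) simp
  also have "(\<integral>\<^sup>+x. ennreal (normal_density 0 s x) \<partial>lborel) = 1"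
    using s(1) by (subst nn_integral_eq_integral) auto
  finally show ?thesis by (simp add: s_def v_def)
qed

text \<open>
  For \<open>\<epsilon>\<close> standard Gaussian, \<open>x - ln (1 + 2 * x) / 2\<close> is the cumulant generating function of
  \<open>1 - \<epsilon>\<^sup>2\<close> at \<open>x\<close>, whose leading term is \<open>x\<^sup>2\<close>. Both bounds follow by comparing derivatives, since
  the derivative of the function is \<open>2 * x / (1 + 2 * x)\<close>.
\<close>

lemma ln_one_plus_double_bounds:
  fixes x :: real
  assumes "0 \<le> x"
  shows "x - ln (1 + 2 * x) / 2 \<le> x\<^sup>2"
    and "x \<le> 1 \<Longrightarrow> x\<^sup>2 / 3 \<le> x - ln (1 + 2 * x) / 2"
proof -
  have *: "0\<^sup>2 - (0 - ln (1 + 2 * 0) / 2) \<le> x\<^sup>2 - (x - ln (1 + 2 * x) / 2)"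
  proof (rule DERIV_nonneg_imp_nondecreasing[OF assms])
    fix y :: real assume y: "0 \<le> y"
    have "((\<lambda>x. x\<^sup>2 - (x - ln (1 + 2 * x) / 2)) has_real_derivative
            2 * y - (1 - 1 / (1 + 2 * y))) (at y)"
      using y by (auto intro!: derivative_eq_intros simp: divide_simps) (simp add: algebra_simps)
    moreover have "2 * y - (1 - 1 / (1 + 2 * y)) \<ge> 0"
      using y by (simp add: field_simps)
    ultimately show "\<exists>z. ((\<lambda>x. x\<^sup>2 - (x - ln (1 + 2 * x) / 2)) has_real_derivative z) (at y) \<and> 0 \<le> z"
      by blast
  qed
  thus "x - ln (1 + 2 * x) / 2 \<le> x\<^sup>2" by simp
  assume "x \<le> 1"
  have "(0 - ln (1 + 2 * 0) / 2) - 0\<^sup>2 / 3 \<le> (x - ln (1 + 2 * x) / 2) - x\<^sup>2 / 3"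
  proof (rule DERIV_nonneg_imp_nondecreasing[OF assms])
    fix y :: real assume y: "0 \<le> y" "y \<le> x"
    have "((\<lambda>x. (x - ln (1 + 2 * x) / 2) - x\<^sup>2 / 3) has_real_derivative
            (1 - 1 / (1 + 2 * y)) - 2 * y / 3) (at y)"
      using y by (auto intro!: derivative_eq_intros simp: divide_simps) (simp add: algebra_simps)
    moreover have "(1 - 1 / (1 + 2 * y)) - 2 * y / 3 \<ge> 0"
      using y \<open>x \<le> 1\<close> mult_left_mono[of y 1 y] by (simp add: field_simps)
    ultimately show "\<exists>z. ((\<lambda>x. (x - ln (1 + 2 * x) / 2) - x\<^sup>2 / 3) has_real_derivative z) (at y) \<and> 0 \<le> z"
      by blast
  qed
  thus "x\<^sup>2 / 3 \<le> x - ln (1 + 2 * x) / 2" by simp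
qed

lemma (in prob_space) nn_integral_exp_neg_weighted_chi_square:
  fixes eps :: "nat \<Rightarrow> 'a \<Rightarrow> real" and w :: "nat \<Rightarrow> real" and s :: real
  assumes I: "finite I" and ind: "indep_vars (\<lambda>_. borel) eps I"
    and gauss: "\<And>i. i \<in> I \<Longrightarrow> distributed M lborel (eps i) (\<lambda>x. ennreal (std_normal_density x))"
    and w: "\<And>i. i \<in> I \<Longrightarrow> 0 \<le> w i" and s: "0 \<le> s"
  shows "(\<integral>\<^sup>+\<omega>. ennreal (exp (- s * (\<Sum>i\<in>I. w i * ((eps i \<omega>)\<^sup>2 - 1)))) \<partial>M)
       = ennreal (exp (\<Sum>i\<in>I. s * w i - ln (1 + 2 * (s * w i)) / 2))"
proof -
  have [measurable]: "eps i \<in> borel_measurable M" if "i \<in> I" for i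
    using ind that by (simp add: indep_vars_def)
  let ?f = "\<lambda>i x. ennreal (exp (- (s * w i) * x\<^sup>2))"
  have "(\<integral>\<^sup>+\<omega>. ennreal (exp (- s * (\<Sum>i\<in>I. w i * ((eps i \<omega>)\<^sup>2 - 1)))) \<partial>M)
      = (\<integral>\<^sup>+\<omega>. (\<Prod>i\<in>I. ennreal (exp (s * w i))) * (\<Prod>i\<in>I. ?f i (eps i \<omega>)) \<partial>M)"
  proof (intro nn_integral_cong)
    fix \<omega>
    have "- s * (\<Sum>i\<in>I. w i * ((eps i \<omega>)\<^sup>2 - 1))
        = (\<Sum>i\<in>I. s * w i) + (\<Sum>i\<in>I. - (s * w i) * (eps i \<omega>)\<^sup>2)"
      by (simp add: sum_distrib_left sum.distrib[symmetric] algebra_simps)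
    thus "ennreal (exp (- s * (\<Sum>i\<in>I. w i * ((eps i \<omega>)\<^sup>2 - 1))))
        = (\<Prod>i\<in>I. ennreal (exp (s * w i))) * (\<Prod>i\<in>I. ?f i (eps i \<omega>))"
      by (simp add: exp_add exp_sum[OF I] prod_ennreal prod_nonneg ennreal_mult)
  qed
  also have "\<dots> = (\<Prod>i\<in>I. ennreal (exp (s * w i))) * (\<integral>\<^sup>+\<omega>. (\<Prod>i\<in>I. ?f i (eps i \<omega>)) \<partial>M)"
    by (intro nn_integral_cmult) measurable
  also have "(\<integral>\<^sup>+\<omega>. (\<Prod>i\<in>I. ?f i (eps i \<omega>)) \<partial>M) = (\<Prod>i\<in>I. \<integral>\<^sup>+\<omega>. ?f i (eps i \<omega>) \<partial>M)"
    by (intro indep_vars_nn_integral[OF I] indep_vars_compose2[OF ind]) auto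
  also have "\<dots> = (\<Prod>i\<in>I. ennreal (1 / sqrt (1 + 2 * (s * w i))))"
    by (intro prod.cong refl nn_integral_exp_neg_std_normal_square gauss) (auto simp: w s)
  also have "(\<Prod>i\<in>I. ennreal (exp (s * w i))) * \<dots>
      = (\<Prod>i\<in>I. ennreal (exp (s * w i - ln (1 + 2 * (s * w i)) / 2)))"
    unfolding prod.distrib[symmetric]
  proof (intro prod.cong refl)
    fix i assume "i \<in> I"
    hence "0 < 1 + 2 * (s * w i)" using w s by (simp add: add_pos_nonneg)
    hence "exp (s * w i - ln (1 + 2 * (s * w i)) / 2) = exp (s * w i) * (1 / sqrt (1 + 2 * (s * w i)))"
      by (simp add: exp_diff flip: ln_sqrt)
    thus "ennreal (exp (s * w i)) * ennreal (1 / sqrt (1 + 2 * (s * w i)))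
        = ennreal (exp (s * w i - ln (1 + 2 * (s * w i)) / 2))"
      by (simp only: ennreal_mult'[OF exp_ge_zero])
  qed
  also have "\<dots> = ennreal (exp (\<Sum>i\<in>I. s * w i - ln (1 + 2 * (s * w i)) / 2))"
    by (simp add: exp_sum[OF I] prod_ennreal)
  finally show ?thesis .
qed

text \<open>
  A weighted chi-square variable is below its mean with a probability that does not depend on the
  number of terms or on the weights. This is what makes a spike of the signal invisible even if the
  random part of the residual fluctuates much more than the spike contributes.

  Let \<open>Z\<close> be the centred sum, \<open>A\<close> the event \<open>Z \<le> 0\<close>, and \<open>U = exp (- s * Z)\<close> with \<open>s\<^sup>2\<close> the inverse of the
  sum of the squared weights. The two bounds on the cumulant generating function make the first
  moment of \<open>U\<close> at least \<open>4 / 3\<close> and the second at most \<open>exp 4\<close>. Off \<open>A\<close> one has \<open>U \<le> 1\<close>, so an excess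
  of at least \<open>1 / 3\<close> must come from \<open>A\<close>, and the bounded second moment prevents \<open>U\<close> from carrying
  this mass on a small event.
\<close>

lemma (in prob_space) prob_weighted_chi_square_le_mean:
  fixes eps :: "nat \<Rightarrow> 'a \<Rightarrow> real" and w :: "nat \<Rightarrow> real"
  assumes I: "finite I" and ind: "indep_vars (\<lambda>_. borel) eps I"
    and gauss: "\<And>i. i \<in> I \<Longrightarrow> distributed M lborel (eps i) (\<lambda>x. ennreal (std_normal_density x))"
    and w: "\<And>i. i \<in> I \<Longrightarrow> 0 \<le> w i"
  shows "exp (- 4) / 9 \<le> prob {\<omega>\<in>space M. (\<Sum>i\<in>I. w i * ((eps i \<omega>)\<^sup>2 - 1)) \<le> 0}"
proof (cases "(\<Sum>i\<in>I. (w i)\<^sup>2) = 0")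
  case True
  hence "\<forall>i\<in>I. w i = 0" using I by (simp add: sum_nonneg_eq_0_iff)
  moreover have "exp (- 4) / 9 \<le> (1::real)"
    by (rule order.trans[of _ "1/9"]) auto
  ultimately show ?thesis by (simp add: prob_space)
next
  case False
  define Q where "Q = (\<Sum>i\<in>I. (w i)\<^sup>2)"
  define s where "s = 1 / sqrt Q"
  define Z where "Z \<omega> = (\<Sum>i\<in>I. w i * ((eps i \<omega>)\<^sup>2 - 1))" for \<omega>
  define A where "A = {\<omega>\<in>space M. Z \<omega> \<le> 0}"
  \<comment> \<open>The weight in \<open>2 * u \<le> t * u\<^sup>2 + 1 / t\<close> below, chosen so that the second-moment term uses up
    exactly half of the excess \<open>1 / 3\<close>.\<close>
  define t where "t = exp (- 4) / (3::real)"
  have Q: "Q > 0" using False unfolding Q_def by (simp add: sum_nonneg order_less_le)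
  have s: "s > 0" and sQ: "s\<^sup>2 * Q = 1" using Q by (auto simp: s_def power_divide)
  have t: "t > 0" by (simp add: t_def)
  have [measurable]: "Z \<in> borel_measurable M"
    unfolding Z_def using ind by (auto simp: indep_vars_def intro!: borel_measurable_sum borel_measurable_times borel_measurable_diff borel_measurable_power)
  have A[measurable]: "A \<in> sets M" unfolding A_def by measurable
  have sw: "s * w i \<le> 1" if "i \<in> I" for i
  proof -
    have "(w i)\<^sup>2 \<le> Q" unfolding Q_def using that I by (intro member_le_sum) auto
    hence "(s * w i)\<^sup>2 \<le> 1" using sQ s by (simp add: power_mult_distrib) (metis mult_left_mono zero_le_power2)
    thus ?thesis by (simp add: abs_square_le_1)
  qed
  have low: "ennreal (4 / 3) \<le> (\<integral>\<^sup>+\<omega>. ennreal (exp (- s * Z \<omega>)) \<partial>M)"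
  proof -
    have "1 / 3 = (\<Sum>i\<in>I. (s * w i)\<^sup>2 / 3)"
      using sQ by (simp add: Q_def power_mult_distrib sum_distrib_left flip: sum_divide_distrib)
    also have "\<dots> \<le> (\<Sum>i\<in>I. s * w i - ln (1 + 2 * (s * w i)) / 2)"
      using sw w s by (intro sum_mono ln_one_plus_double_bounds(2)) auto
    finally have "4 / 3 \<le> exp (\<Sum>i\<in>I. s * w i - ln (1 + 2 * (s * w i)) / 2)"
      using exp_ge_add_one_self[of "\<Sum>i\<in>I. s * w i - ln (1 + 2 * (s * w i)) / 2"] by linarith
    thus ?thesis unfolding Z_def
      using s by (subst nn_integral_exp_neg_weighted_chi_square[OF I ind gauss w]) (auto intro: ennreal_leI)
  qed
  have up: "(\<integral>\<^sup>+\<omega>. ennreal (exp (- (2 * s) * Z \<omega>)) \<partial>M) \<le> ennreal (exp 4)"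
  proof -
    have "(\<Sum>i\<in>I. 2 * s * w i - ln (1 + 2 * (2 * s * w i)) / 2) \<le> (\<Sum>i\<in>I. (2 * s * w i)\<^sup>2)"
      using w s by (intro sum_mono ln_one_plus_double_bounds(1)) auto
    also have "\<dots> = 4" using sQ by (simp add: Q_def power_mult_distrib flip: sum_distrib_left)
    finally show ?thesis unfolding Z_def
      using s by (subst nn_integral_exp_neg_weighted_chi_square[OF I ind gauss w]) (auto intro: ennreal_leI)
  qed
  \<comment> \<open>The Cauchy-Schwarz inequality for \<open>U\<close> and the indicator of \<open>A\<close>, in its pointwise form.\<close>
  have pw: "exp (- s * Z \<omega>) \<le> 1 + t / 2 * exp (- (2 * s) * Z \<omega>) + 1 / (2 * t) * indicator A \<omega>"
    if "\<omega> \<in> space M" for \<omega>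
  proof (cases "Z \<omega> \<le> 0")
    case True
    define u where "u = exp (- s * Z \<omega>)"
    have u2: "exp (- (2 * s) * Z \<omega>) = u\<^sup>2"
      by (simp add: u_def power2_eq_square flip: exp_add)
    have "0 \<le> (t * u - 1)\<^sup>2 / (2 * t)" using t by simp
    also have "\<dots> = t / 2 * u\<^sup>2 + 1 / (2 * t) - u"
      using t by (simp add: field_simps power2_eq_square)
    finally show ?thesis using True that unfolding u2 u_def[symmetric] by (simp add: A_def)
  next
    case False
    hence "exp (- s * Z \<omega>) \<le> 1" using s by simp
    thus ?thesis using t by (smt (verit) exp_gt_zero indicator_pos_le mult_nonneg_nonneg divide_nonneg_nonneg)
  qed
  have "ennreal (4 / 3) \<le> (\<integral>\<^sup>+\<omega>. 1 + ennreal (t / 2) * ennreal (exp (- (2 * s) * Z \<omega>))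
            + ennreal (1 / (2 * t)) * indicator A \<omega> \<partial>M)"
  proof (rule order.trans[OF low], intro nn_integral_mono)
    fix \<omega> assume "\<omega> \<in> space M"
    from ennreal_leI[OF pw[OF this]] t
    show "ennreal (exp (- s * Z \<omega>)) \<le> 1 + ennreal (t / 2) * ennreal (exp (- (2 * s) * Z \<omega>))
            + ennreal (1 / (2 * t)) * indicator A \<omega>"
      by (auto simp: ennreal_plus simp flip: ennreal_mult' split: split_indicator)
  qed
  also have "\<dots> = 1 + ennreal (t / 2) * (\<integral>\<^sup>+\<omega>. ennreal (exp (- (2 * s) * Z \<omega>)) \<partial>M)
            + ennreal (1 / (2 * t)) * emeasure M A"
    by (subst nn_integral_add; (subst nn_integral_add)?) (auto simp: nn_integral_cmult emeasure_space_1)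
  also have "\<dots> \<le> 1 + ennreal (t / 2) * ennreal (exp 4) + ennreal (1 / (2 * t)) * emeasure M A"
    by (intro add_mono mult_left_mono up) auto
  also have "\<dots> = ennreal (1 + t / 2 * exp 4 + 1 / (2 * t) * prob A)"
    using t by (simp add: emeasure_eq_measure ennreal_plus flip: ennreal_mult')
  finally have "4 / 3 \<le> 1 + t / 2 * exp 4 + 1 / (2 * t) * prob A"
    using t by (subst (asm) ennreal_le_iff) (auto simp: add_nonneg_nonneg)
  moreover have "t * exp 4 = 1 / 3" by (simp add: t_def flip: exp_add)
  ultimately have "1 / 6 \<le> prob A / (2 * t)" by simp
  hence "t / 3 \<le> prob A" using t by (simp add: field_simps)
  thus ?thesis by (simp add: A_def Z_def t_def)
qed

lemma (in prob_space) prob_std_normal_large: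
  fixes X :: "'a \<Rightarrow> real" and T :: real
  assumes X: "distributed M lborel X (\<lambda>x. ennreal (std_normal_density x))" and T: "0 < T"
  shows "prob {\<omega>\<in>space M. T \<le> \<bar>X \<omega>\<bar>} \<le> 1 / T\<^sup>2"
proof -
  have [measurable]: "X \<in> borel_measurable M" using X by (simp add: distributed_def)
  have "integrable lborel (\<lambda>x. std_normal_density x * x\<^sup>2)"
    using integrable_std_normal_moment[of 2] by simp
  hence "integrable M (\<lambda>\<omega>. (X \<omega>)\<^sup>2)"
    by (subst (asm) distributed_integrable[OF X]) auto
  from Chebyshev_inequality[OF _ this T] show ?thesis
    using standard_normal_distributed_expectation[OF X] standard_normal_distributed_variance[OF X] by simp
qed

section \<open>Early stopping hides a spike\<close>

lemma stopping_time_le: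
  assumes "smoothed_residual lam D alpha Y m \<le> kappa"
  shows "stopping_time lam D alpha kappa Y \<le> m"
  unfolding stopping_time_def using assms by (intro cInf_lower) auto

text \<open>
  The critical value leaves room for the expected noise in all \<open>D\<close> coordinates, while the residual
  at \<open>n - 1\<close> contains only the coordinates from \<open>n\<close> on. The unused part \<open>\<delta>\<^sup>2 \<Sum>i\<le>n. \<lambda>\<^sub>i powr (2\<alpha>)\<close> pays
  for coordinate \<open>n\<close>: one half for the signal, by the condition on the height of the spike, and the
  other half for the bounded noise, because the weights decrease and \<open>n\<close> is large. The remaining
  coordinates carry noise only, which by assumption stays below its mean.
\<close>

lemma spike_residual_le_noise_budget:
  fixes lam e :: "nat \<Rightarrow> real" and n D :: nat
  assumes sv: "singular_values lam D" and decay: "poly_spectral_decay p C_A lam D"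
    and C_A: "C_A \<ge> 1" and alpha: "alpha \<ge> 0"
    and n: "1 \<le> n" "n \<le> D" "4 * T\<^sup>2 \<le> real n"
    and spike: "4 * C_A powr (4 * alpha + 2) * r\<^sup>2
        \<le> delta\<^sup>2 * real n powr (2 * beta + 2 * p + 2 * alpha * p)
            * (\<Sum>i=1..n. real i powr (- (2 * alpha * p)))"
    and tail: "(\<Sum>i\<in>{n+1..D}. lam i powr (2 * alpha) * ((e i)\<^sup>2 - 1)) \<le> 0"
    and bound: "\<bar>e n\<bar> \<le> T"
  shows "smoothed_residual lam D alpha
           (observation lam (\<lambda>i. if i = n then r * real n powr (- beta) else 0) delta e) (n - 1)
         \<le> (\<Sum>i=1..D. lam i powr (2 * alpha) * delta\<^sup>2)"
proof -
  define w where "w i = lam i powr (2 * alpha)" for i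
  define a where "a = lam n * (r * real n powr (- beta))"
  define S where "S = (\<Sum>i=1..n. real i powr (- (2 * alpha * p)))"
  define N where "N = real n powr (2 * beta + 2 * p + 2 * alpha * p)"
  have N: "N > 0" using n by (simp add: N_def)
  have lam: "lam i > 0" if "1 \<le> i" "i \<le> D" for i
    using sv that by (simp add: singular_values_def)
  have w0: "w i \<ge> 0" for i by (simp add: w_def)
  have Sw: "C_A powr (- (2 * alpha)) * S \<le> (\<Sum>i=1..n. w i)"
    unfolding S_def sum_distrib_left
  proof (rule sum_mono)
    fix i assume i: "i \<in> {1..n}"
    have "C_A powr (- (2 * alpha)) * real i powr (- (2 * alpha * p))
        = (inverse C_A * real i powr (- p)) powr (2 * alpha)"
      using C_A i by (simp add: powr_mult powr_powr powr_minus inverse_powr mult_ac)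
    also have "\<dots> \<le> w i"
      unfolding w_def using decay i n alpha C_A
      by (intro powr_mono2) (auto simp: poly_spectral_decay_def)
    finally show "C_A powr (- (2 * alpha)) * real i powr (- (2 * alpha * p)) \<le> w i" .
  qed
  have signal: "2 * (w n * a\<^sup>2) \<le> delta\<^sup>2 / 2 * (\<Sum>i=1..n. w i)"
  proof -
    have "w n * (lam n)\<^sup>2 = lam n powr (2 * alpha + 2)"
      using lam[of n] n by (simp add: w_def powr_add)
    also have "\<dots> \<le> (C_A * real n powr (- p)) powr (2 * alpha + 2)"
      using decay n alpha lam[of n] by (intro powr_mono2) (auto simp: poly_spectral_decay_def)
    also have "\<dots> = C_A powr (2 * alpha + 2) * real n powr (- (2 * alpha * p + 2 * p))"
      using C_A n by (simp add: powr_mult powr_powr algebra_simps)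
    finally have "w n * (lam n)\<^sup>2 * (r\<^sup>2 * real n powr (- (2 * beta)))
        \<le> C_A powr (2 * alpha + 2) * real n powr (- (2 * alpha * p + 2 * p))
            * (r\<^sup>2 * real n powr (- (2 * beta)))"
      by (intro mult_right_mono) auto
    moreover have "w n * a\<^sup>2 = w n * (lam n)\<^sup>2 * (r\<^sup>2 * real n powr (- (2 * beta)))"
    proof -
      have "(real n powr (- beta))\<^sup>2 = real n powr (- (2 * beta))"
        by (simp add: power2_eq_square flip: powr_add)
      thus ?thesis by (simp add: a_def power_mult_distrib)
    qed
    moreover have "real n powr (- (2 * alpha * p + 2 * p)) * real n powr (- (2 * beta)) = 1 / N"
    proof -
      have "1 / N = real n powr (- (2 * beta + 2 * p + 2 * alpha * p))"
        unfolding N_def by (rule powr_minus_divide[symmetric])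
      also have "\<dots> = real n powr (- (2 * alpha * p + 2 * p) + - (2 * beta))"
        by (simp add: algebra_simps)
      finally show ?thesis by (simp only: powr_add)
    qed
    ultimately have "w n * a\<^sup>2 \<le> C_A powr (2 * alpha + 2) * r\<^sup>2 * (1 / N)"
      by (metis mult.assoc mult.left_commute)
    also have "\<dots> = C_A powr (2 * alpha + 2) * r\<^sup>2 / N" by simp
    also have "C_A powr (2 * alpha + 2) = C_A powr (- (2 * alpha)) * C_A powr (4 * alpha + 2)"
      by (simp flip: powr_add)
    also have "C_A powr (- (2 * alpha)) * C_A powr (4 * alpha + 2) * r\<^sup>2 / N
        = C_A powr (- (2 * alpha)) / (4 * N) * (4 * C_A powr (4 * alpha + 2) * r\<^sup>2)"
      by simp
    also have "\<dots> \<le> C_A powr (- (2 * alpha)) / (4 * N) * (delta\<^sup>2 * N * S)"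
      using spike N unfolding N_def S_def by (intro mult_left_mono) auto
    also have "\<dots> = delta\<^sup>2 / 4 * (C_A powr (- (2 * alpha)) * S)"
      using N by simp
    also have "\<dots> \<le> delta\<^sup>2 / 4 * (\<Sum>i=1..n. w i)"
      by (intro mult_left_mono Sw) auto
    finally show ?thesis by simp
  qed
  have noise: "2 * (w n * (delta\<^sup>2 * T\<^sup>2)) \<le> delta\<^sup>2 / 2 * (\<Sum>i=1..n. w i)"
  proof -
    have "4 * T\<^sup>2 * w n \<le> real n * w n"
      by (intro mult_right_mono n w0)
    also have "\<dots> = (\<Sum>i=1..n. w n)" by simp
    also have "\<dots> \<le> (\<Sum>i=1..n. w i)"
      unfolding w_def using sv n alpha lam
      by (intro sum_mono powr_mono2) (auto simp: singular_values_def less_imp_le)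
    finally have "delta\<^sup>2 / 2 * (4 * T\<^sup>2 * w n) \<le> delta\<^sup>2 / 2 * (\<Sum>i=1..n. w i)"
      by (intro mult_left_mono) auto
    thus ?thesis by (simp add: mult_ac)
  qed
  have head: "w n * (a + delta * e n)\<^sup>2 \<le> delta\<^sup>2 * (\<Sum>i=1..n. w i)"
  proof -
    have "(e n)\<^sup>2 \<le> T\<^sup>2" using bound by (simp add: abs_le_square_iff[symmetric])
    hence "delta\<^sup>2 * (e n)\<^sup>2 \<le> delta\<^sup>2 * T\<^sup>2" by (intro mult_left_mono) auto
    moreover have "(a + delta * e n)\<^sup>2 \<le> 2 * a\<^sup>2 + 2 * (delta\<^sup>2 * (e n)\<^sup>2)"
      using zero_le_power2[of "a - delta * e n"]
      by (simp add: power2_diff power2_sum power_mult_distrib)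
    ultimately have "(a + delta * e n)\<^sup>2 \<le> 2 * a\<^sup>2 + 2 * (delta\<^sup>2 * T\<^sup>2)" by linarith
    hence "w n * (a + delta * e n)\<^sup>2 \<le> w n * (2 * a\<^sup>2 + 2 * (delta\<^sup>2 * T\<^sup>2))"
      by (intro mult_left_mono w0)
    also have "\<dots> = 2 * (w n * a\<^sup>2) + 2 * (w n * (delta\<^sup>2 * T\<^sup>2))"
      by (simp add: algebra_simps)
    finally show ?thesis using signal noise by linarith
  qed
  have rest: "(\<Sum>i=n+1..D. w i * (delta * e i)\<^sup>2) \<le> delta\<^sup>2 * (\<Sum>i=n+1..D. w i)"
  proof -
    have "(\<Sum>i=n+1..D. w i * (delta * e i)\<^sup>2) - delta\<^sup>2 * (\<Sum>i=n+1..D. w i)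
        = delta\<^sup>2 * (\<Sum>i=n+1..D. w i * ((e i)\<^sup>2 - 1))"
      by (simp add: sum_distrib_left power_mult_distrib algebra_simps flip: sum_subtractf)
    moreover have "\<dots> \<le> 0"
      using tail by (intro mult_nonneg_nonpos) (auto simp: w_def)
    ultimately show ?thesis by linarith
  qed
  have "smoothed_residual lam D alpha
           (observation lam (\<lambda>i. if i = n then r * real n powr (- beta) else 0) delta e) (n - 1)
      = (\<Sum>i=n..D. w i * (lam i * (if i = n then r * real n powr (- beta) else 0) + delta * e i)\<^sup>2)"
    using n by (simp add: smoothed_residual_def observation_def w_def)
  also have "\<dots> = w n * (a + delta * e n)\<^sup>2 + (\<Sum>i=n+1..D. w i * (delta * e i)\<^sup>2)"
  proof -
    have "(\<Sum>i=n+1..D. w i * (lam i * (if i = n then r * real n powr (- beta) else 0) + delta * e i)\<^sup>2)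
        = (\<Sum>i=n+1..D. w i * (delta * e i)\<^sup>2)"
      by (intro sum.cong) auto
    thus ?thesis using n by (subst sum.atLeast_Suc_atMost) (auto simp: a_def)
  qed
  also have "\<dots> \<le> delta\<^sup>2 * (\<Sum>i=1..n. w i) + delta\<^sup>2 * (\<Sum>i=n+1..D. w i)"
    by (intro add_mono head rest)
  also have "\<dots> = delta\<^sup>2 * (\<Sum>i=1..D. w i)"
  proof -
    have "(\<Sum>i=1..D. w i) = (\<Sum>i=1..n. w i) + (\<Sum>i=n+1..D. w i)"
      using n sum.ub_add_nat[of 1 n w "D - n"] by simp
    thus ?thesis by (simp add: algebra_simps)
  qed
  finally show ?thesis by (simp add: w_def sum_distrib_right mult.commute sum_distrib_left)
qed

text \<open>
  The spike at \<open>n\<close> of height \<open>r * n powr (- \<beta>)\<close> lies on the boundary of the ellipsoid. If the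
  procedure stops before \<open>n\<close>, then the estimator vanishes at \<open>n\<close> and the whole spike is lost.
  The noise after \<open>n\<close> is below its mean with probability at least \<open>exp (- 4) / 9\<close>, and the noise in
  coordinate \<open>n\<close> exceeds \<open>T\<close> with at most half that probability if \<open>T\<^sup>2 = 18 * exp 4\<close>; hence the
  requirement \<open>n \<ge> 4 * T\<^sup>2 = 72 * exp 4\<close>.
\<close>

lemma sup_stopped_risk_lower_bound:
  assumes noise: "std_gaussian_noise M eps D"
    and sv: "singular_values lam D" and decay: "poly_spectral_decay p C_A lam D"
    and C_A: "C_A \<ge> 1" and alpha: "alpha \<ge> 0"
    and kappa: "(\<Sum>i=1..D. lam i powr (2 * alpha) * delta\<^sup>2) \<le> kappa"
    and n: "n \<le> D" "72 * exp 4 \<le> real n"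
    and spike: "4 * C_A powr (4 * alpha + 2) * r\<^sup>2
        \<le> delta\<^sup>2 * real n powr (2 * beta + 2 * p + 2 * alpha * p)
            * (\<Sum>i=1..n. real i powr (- (2 * alpha * p)))"
  shows "ennreal (exp (- 4) / 18 * (r\<^sup>2 * real n powr (- (2 * beta))))
      \<le> (SUP mu\<in>sobolev_ellipsoid beta r D. stopped_risk M eps lam D delta alpha kappa mu)"
proof -
  interpret prob_space M using noise by (simp add: std_gaussian_noise_def)
  have ind: "indep_vars (\<lambda>_. borel) eps {1..D}"
    and gauss: "\<And>i. i \<in> {1..D} \<Longrightarrow> distributed M lborel (eps i) (\<lambda>x. ennreal (std_normal_density x))"
    using noise by (auto simp: std_gaussian_noise_def)
  have n1: "1 \<le> n"
  proof (rule ccontr)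
    assume "\<not> 1 \<le> n"
    hence "real n = 0" by simp
    with n(2) show False by (simp add: not_le)
  qed
  have rv[measurable]: "eps i \<in> borel_measurable M" if "i \<in> {1..D}" for i
    using ind that by (simp add: indep_vars_def)
  define T where "T = sqrt (18 * exp 4)"
  have T: "T > 0" "T\<^sup>2 = 18 * exp 4" by (auto simp: T_def)
  define mu where "mu = (\<lambda>i. if i = n then r * real n powr (- beta) else 0)"
  have mu_n: "(mu n)\<^sup>2 = r\<^sup>2 * real n powr (- (2 * beta))"
    by (simp add: mu_def power_mult_distrib power2_eq_square flip: powr_add)
  have mu_in: "mu \<in> sobolev_ellipsoid beta r D"
  proof -
    have "(\<Sum>i=1..D. real i powr (2 * beta) * (mu i)\<^sup>2) = (\<Sum>i\<in>{n}. real i powr (2 * beta) * (mu i)\<^sup>2)"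
      using n n1 by (intro sum.mono_neutral_right) (auto simp: mu_def)
    also have "\<dots> = r\<^sup>2" using n1 unfolding sum.insert_if by (simp add: mu_n powr_minus)
    finally show ?thesis by (simp add: sobolev_ellipsoid_def)
  qed
  define A where "A = {\<omega>\<in>space M. (\<Sum>i\<in>{n+1..D}. lam i powr (2 * alpha) * ((eps i \<omega>)\<^sup>2 - 1)) \<le> 0}"
  define B where "B = {\<omega>\<in>space M. T \<le> \<bar>eps n \<omega>\<bar>}"
  have [measurable]: "eps n \<in> borel_measurable M" using n n1 by (intro rv) auto
  have A: "A \<in> sets M" unfolding A_def
    by measurable
  have B: "B \<in> sets M" unfolding B_def by measurable
  have "exp (- 4) / 9 \<le> prob A"
    unfolding A_def using n1
    by (intro prob_weighted_chi_square_le_mean indep_vars_subset[OF ind] gauss) auto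
  moreover have "prob B \<le> exp (- 4) / 18"
    using prob_std_normal_large[OF gauss T(1), of n] n n1
    by (simp add: B_def T(2) exp_minus field_simps)
  moreover have "prob A \<le> prob (A - B) + prob B"
  proof -
    have "prob A \<le> prob ((A - B) \<union> B)"
      using A B by (intro finite_measure_mono) auto
    also have "\<dots> \<le> prob (A - B) + prob B"
      using A B by (intro measure_Un_le) auto
    finally show ?thesis .
  qed
  ultimately have AB: "exp (- 4) / 18 \<le> prob (A - B)" by linarith
  have loss: "ennreal ((mu n)\<^sup>2) * indicator (A - B) \<omega>
      \<le> ennreal (let Y = observation lam mu delta (\<lambda>i. eps i \<omega>);
                     tau = stopping_time lam D alpha kappa Y
                 in sq_norm D (\<lambda>i. svd_estimator lam Y tau i - mu i))" for \<omega>
  proof (cases "\<omega> \<in> A - B")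
    case True
    define Y where "Y = observation lam mu delta (\<lambda>i. eps i \<omega>)"
    define tau where "tau = stopping_time lam D alpha kappa Y"
    have "smoothed_residual lam D alpha Y (n - 1) \<le> kappa"
      unfolding Y_def mu_def
      by (rule order.trans[OF spike_residual_le_noise_budget[OF sv decay C_A alpha n1 n(1), of T] kappa])
         (use True n(2) T spike in \<open>auto simp: A_def B_def\<close>)
    hence "tau < n" using stopping_time_le n1 unfolding tau_def by fastforce
    hence "svd_estimator lam Y tau n = 0" by (simp add: svd_estimator_def)
    hence "(mu n)\<^sup>2 = (svd_estimator lam Y tau n - mu n)\<^sup>2" by simp
    also have "\<dots> \<le> sq_norm D (\<lambda>i. svd_estimator lam Y tau i - mu i)"
      unfolding sq_norm_def using n n1
      by (intro member_le_sum[where f = "\<lambda>i. (svd_estimator lam Y tau i - mu i)\<^sup>2"]) auto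
    finally show ?thesis
      using True by (simp add: Let_def Y_def tau_def ennreal_leI)
  qed simp
  have "ennreal (exp (- 4) / 18 * (r\<^sup>2 * real n powr (- (2 * beta)))) \<le> ennreal (prob (A - B) * (mu n)\<^sup>2)"
    unfolding mu_n[symmetric] by (intro ennreal_leI mult_right_mono AB) auto
  also have "\<dots> = (\<integral>\<^sup>+\<omega>. ennreal ((mu n)\<^sup>2) * indicator (A - B) \<omega> \<partial>M)"
    using A B by (subst nn_integral_cmult_indicator) (auto simp: emeasure_eq_measure ennreal_mult mult.commute)
  also have "\<dots> \<le> stopped_risk M eps lam D delta alpha kappa mu"
    unfolding stopped_risk_def by (intro nn_integral_mono loss)
  also have "\<dots> \<le> (SUP mu\<in>sobolev_ellipsoid beta r D. stopped_risk M eps lam D delta alpha kappa mu)"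
    by (intro SUP_upper mu_in)
  finally show ?thesis .
qed

section \<open>Location of the spike\<close>

lemma sum_powr_ge_integral:
  fixes c :: real
  assumes c: "0 < c" "c \<le> 1"
  shows "((real n + 1) powr c - 1) / c \<le> (\<Sum>i=1..n. real i powr (c - 1))"
proof (induction n)
  case (Suc n)
  obtain z where z: "real n + 1 < z" "z < real n + 2"
    "(real n + 2) powr c - (real n + 1) powr c = ((real n + 2) - (real n + 1)) * (c * z powr (c - 1))"
  proof -
    have "((\<lambda>x. x powr c) has_real_derivative c * x powr (c - 1)) (at x)"
      if "real n + 1 \<le> x" "x \<le> real n + 2" for x
      using that by (intro has_real_derivative_powr) auto
    from MVT2[OF _ this, of "real n + 1" "real n + 2"] that show ?thesis by auto
  qed
  have "z powr (c - 1) \<le> (real n + 1) powr (c - 1)"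
    using z c by (intro powr_mono2') auto
  hence "(real n + 2) powr c - (real n + 1) powr c \<le> c * (real n + 1) powr (c - 1)"
    using z(3) c by simp
  hence "((real n + 2) powr c - 1) / c \<le> ((real n + 1) powr c - 1) / c + (real n + 1) powr (c - 1)"
    using c by (simp add: field_simps)
  also have "\<dots> \<le> (\<Sum>i=1..n. real i powr (c - 1)) + (real n + 1) powr (c - 1)"
    using Suc by simp
  finally show ?case by (simp add: add_ac)
qed simp

text \<open>
  Here \<open>V\<close> is the effective signal-to-noise ratio, and the index is \<open>(L * V) powr (1 / b)\<close> rounded up.
  Rounding must not cost a factor that grows with \<open>\<beta>\<close>: once the index exceeds \<open>2 * \<beta> + 1\<close>, it
  increases at most by the factor \<open>1 + 1 / (2 * \<beta> + 1)\<close>, whose power \<open>2 * \<beta>\<close> is at most \<open>exp 1\<close>.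
  Similarly \<open>L\<close> enters with an exponent \<open>2 * \<beta> / b \<le> 1\<close> only, so that the constant
  \<open>exp (- 1) / L\<close> is uniform in \<open>\<beta>\<close>. As \<open>V\<close> is at most \<open>r\<^sup>2 / \<delta>\<^sup>2\<close> and \<open>b\<close> at least
  \<open>2 * \<beta> + 2 * p + 1\<close>, the index is of at most the order of the minimax index and hence below \<open>D\<close>.
\<close>

lemma eventually_truncation_index:
  fixes beta p r b L N0 :: real and V :: "real \<Rightarrow> real" and D :: "real \<Rightarrow> nat"
  assumes beta: "0 \<le> beta" and p: "0 \<le> p" and r: "0 < r"
    and b: "2 * beta + 2 * p + 1 \<le> b" and L: "1 \<le> L"
    and V: "filterlim V at_top (at_right 0)"
    and VX: "\<forall>\<^sub>F delta in at_right 0. V delta \<le> r\<^sup>2 / delta\<^sup>2"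
    and D: "(\<lambda>delta. minimax_index beta p r delta) \<in> o[at_right 0](\<lambda>delta. real (D delta))"
  shows "\<forall>\<^sub>F delta in at_right 0. \<exists>n. n \<le> D delta \<and> N0 \<le> real n \<and>
           L * V delta \<le> real n powr b \<and>
           exp (- 1) / L * (1 / V delta) powr (2 * beta / b) \<le> real n powr (- (2 * beta))"
proof -
  define Z where "Z = max N0 (2 * beta + 1)"
  define b0 where "b0 = 2 * beta + 2 * p + 1"
  have b0: "1 \<le> b0" "b0 \<le> b" using beta p b by (auto simp: b0_def)
  have Z: "1 \<le> Z" "N0 \<le> Z" "2 * beta + 1 \<le> Z" using beta by (auto simp: Z_def)
  have "\<forall>\<^sub>F delta in at_right 0. Z powr b \<le> V delta"
    using V by (simp add: filterlim_at_top)
  moreover have "\<forall>\<^sub>F delta in at_right 0.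
      norm (minimax_index beta p r delta) \<le> 1 / (2 * L) * norm (real (D delta))"
    using L by (intro landau_o.smallD[OF D]) auto
  ultimately show ?thesis using VX
  proof eventually_elim
    case (elim delta)
    define v where "v = V delta"
    define x where "x = (L * v) powr (1 / b)"
    define n where "n = nat \<lceil>x\<rceil>"
    have v1: "1 \<le> v" using elim(1) Z b0 ge_one_powr_ge_zero[of Z b] by (simp add: v_def)
    have LV: "v \<le> L * v" using L v1 mult_right_mono[of 1 L v] by simp
    hence LV1: "1 \<le> L * v" using v1 by linarith
    have xb: "x powr b = L * v" using b0 L v1 by (simp add: x_def powr_powr)
    have xZ: "Z \<le> x"
    proof -
      have "Z = (Z powr b) powr (1 / b)" using b0 Z by (simp add: powr_powr)
      also have "\<dots> \<le> x"
        unfolding x_def using elim(1) LV b0 by (intro powr_mono2) (auto simp: v_def)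
      finally show ?thesis .
    qed
    have n: "x \<le> real n" "real n \<le> x + 1"
      unfolding n_def using xZ Z by linarith+
    have "real n \<le> real (D delta)"
    proof -
      have "x \<le> (L * v) powr (1 / b0)"
        unfolding x_def using b0 LV1 by (intro powr_mono) (auto simp: frac_le)
      also have "\<dots> \<le> (L * (r\<^sup>2 / delta\<^sup>2)) powr (1 / b0)"
        using b0 L elim(3) v1 by (intro powr_mono2 mult_left_mono) (auto simp: v_def)
      also have "\<dots> = L powr (1 / b0) * minimax_index beta p r delta"
        unfolding minimax_index_def b0_def[symmetric] using L by (intro powr_mult)
      also have "\<dots> \<le> L powr 1 * minimax_index beta p r delta"
        using b0 L by (intro mult_right_mono powr_mono) (auto simp: minimax_index_def)
      finally have "x \<le> L * minimax_index beta p r delta" using L by simp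
      moreover have "2 * L * minimax_index beta p r delta \<le> real (D delta)"
        using elim(2) L by (simp add: minimax_index_def field_simps)
      ultimately show ?thesis using n xZ Z by linarith
    qed
    moreover have "N0 \<le> real n" using n xZ Z by linarith
    moreover have "L * v \<le> real n powr b"
      unfolding xb[symmetric] using n xZ Z b0 by (intro powr_mono2) auto
    moreover have "exp (- 1) / L * (1 / v) powr (2 * beta / b) \<le> real n powr (- (2 * beta))"
    proof -
      have "1 \<le> x / (2 * beta + 1)" using xZ Z beta by simp
      hence "real n \<le> x * (1 + 1 / (2 * beta + 1))" using n by (simp add: distrib_left)
      also have "\<dots> \<le> x * exp (1 / (2 * beta + 1))"
        using xZ Z by (intro mult_left_mono exp_ge_add_one_self) auto
      finally have "real n powr (2 * beta) \<le> (x * exp (1 / (2 * beta + 1))) powr (2 * beta)"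
        using beta by (intro powr_mono2) auto
      also have "\<dots> = x powr (2 * beta) * exp (2 * beta / (2 * beta + 1))"
        using xZ Z by (simp add: powr_mult exp_powr_real)
      also have "\<dots> \<le> x powr (2 * beta) * exp 1"
        using beta by (intro mult_left_mono) auto
      also have "x powr (2 * beta) = (L * v) powr (2 * beta / b)"
        by (simp add: x_def powr_powr)
      also have "\<dots> = L powr (2 * beta / b) * v powr (2 * beta / b)"
        using L v1 by (simp add: powr_mult)
      also have "\<dots> \<le> L powr 1 * v powr (2 * beta / b)"
        using L beta b p by (intro mult_right_mono powr_mono) (auto simp: field_simps)
      finally have le: "real n powr (2 * beta) \<le> L * v powr (2 * beta / b) * exp 1"
        using L by simp
      have "exp (- 1) / L * (1 / v) powr (2 * beta / b) = 1 / (L * v powr (2 * beta / b) * exp 1)"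
        using v1 by (simp add: exp_minus powr_divide field_simps)
      also have "\<dots> \<le> 1 / real n powr (2 * beta)"
        using n xZ Z by (intro divide_left_mono[OF le]) (use L v1 in auto)
      finally show ?thesis by (simp add: powr_minus_divide)
    qed
    ultimately show ?case by (auto simp: v_def)
  qed
qed

text \<open>
  The three regimes of the rate come from the growth of \<open>\<Sum>i\<le>n. i powr (- 2\<alpha>p)\<close>, which is
  \<open>n powr (1 - 2\<alpha>p) / (1 - 2\<alpha>p)\<close>, \<open>ln n\<close> or bounded. Each regime is brought into the form that the
  rate is \<open>r\<^sup>2 * V powr (- 2\<beta>/b)\<close> and that \<open>n powr b \<ge> L * V\<close> suffices for a spike at \<open>n\<close> to be hidden.
  At \<open>\<alpha>p = 1/2\<close> the logarithm of \<open>n\<close> is smaller than that of the signal-to-noise ratio by a factor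
  of order \<open>b\<close>, which \<open>L\<close> has to compensate; this is where an upper bound on \<open>\<beta>\<close> enters the constant.
\<close>

lemma rate_index_asymptotics:
  fixes alpha beta p r K L :: real
  assumes alpha: "0 \<le> alpha" and beta: "0 \<le> beta" and p: "0 \<le> p" and r: "0 < r"
    and K: "1 \<le> K" and L: "2 * K \<le> L"
    and L_crit: "alpha * p = 1 / 2 \<longrightarrow> 2 * K * (2 * beta + 2 * p + 1) \<le> L"
  obtains V :: "real \<Rightarrow> real" and b N0 :: real where
    "2 * beta + 2 * p + 1 \<le> b"
    "filterlim V at_top (at_right 0)"
    "\<forall>\<^sub>F delta in at_right 0. V delta \<le> r\<^sup>2 / delta\<^sup>2"
    "\<And>delta. rate beta r p alpha delta = r\<^sup>2 * (1 / V delta) powr (2 * beta / b)"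
    "\<forall>\<^sub>F delta in at_right 0. \<forall>n. N0 \<le> real n \<longrightarrow> L * V delta \<le> real n powr b \<longrightarrow>
        K * (r\<^sup>2 / delta\<^sup>2) \<le> real n powr (2 * beta + 2 * p + 2 * alpha * p)
            * (\<Sum>i=1..n. real i powr (- (2 * alpha * p)))"
proof -
  have X_top: "filterlim (\<lambda>delta. r\<^sup>2 / delta\<^sup>2) at_top (at_right 0)"
    using r by real_asymp
  consider "alpha * p < 1 / 2" | "alpha * p = 1 / 2" | "alpha * p > 1 / 2" by linarith
  thus thesis
  proof cases
    case 1
    define c where "c = 1 - 2 * alpha * p"
    have c: "0 < c" "c \<le> 1" using 1 alpha p by (auto simp: c_def)
    show ?thesis
    proof (rule that[of "2 * beta + 2 * p + 1" "\<lambda>delta. c * (r\<^sup>2 / delta\<^sup>2)" "max 1 (2 powr (1 / c))"])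
      show "filterlim (\<lambda>delta. c * (r\<^sup>2 / delta\<^sup>2)) at_top (at_right 0)"
        by (rule filterlim_tendsto_pos_mult_at_top[OF tendsto_const c(1) X_top])
      show "\<forall>\<^sub>F delta in at_right 0. c * (r\<^sup>2 / delta\<^sup>2) \<le> r\<^sup>2 / delta\<^sup>2"
        using c by (intro always_eventually allI mult_left_le_one_le) auto
      show "rate beta r p alpha delta
          = r\<^sup>2 * (1 / (c * (r\<^sup>2 / delta\<^sup>2))) powr (2 * beta / (2 * beta + 2 * p + 1))" for delta
        using 1 by (simp add: rate_def c_def mult_ac)
      have "K * (r\<^sup>2 / delta\<^sup>2) \<le> real n powr (2 * beta + 2 * p + 2 * alpha * p)
          * (\<Sum>i=1..n. real i powr (- (2 * alpha * p)))"
        if n: "max 1 (2 powr (1 / c)) \<le> real n"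
          and nb: "L * (c * (r\<^sup>2 / delta\<^sup>2)) \<le> real n powr (2 * beta + 2 * p + 1)" for n delta
      proof -
        have "2 = (2 powr (1 / c)) powr c" using c by (simp add: powr_powr)
        also have "\<dots> \<le> real n powr c" using n c by (intro powr_mono2) auto
        finally have "2 \<le> real n powr c" .
        moreover have "real n powr c \<le> (real n + 1) powr c" using c by (intro powr_mono2) auto
        ultimately have "real n powr c / 2 \<le> (real n + 1) powr c - 1" by linarith
        hence "real n powr c / 2 / c \<le> ((real n + 1) powr c - 1) / c"
          using c by (intro divide_right_mono) auto
        also have "\<dots> \<le> (\<Sum>i=1..n. real i powr (- (2 * alpha * p)))"
          using sum_powr_ge_integral[OF c, of n] by (simp add: c_def)
        finally have S: "real n powr c / (2 * c) \<le> (\<Sum>i=1..n. real i powr (- (2 * alpha * p)))"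
          by simp
        have "2 * K * (c * (r\<^sup>2 / delta\<^sup>2)) \<le> L * (c * (r\<^sup>2 / delta\<^sup>2))"
          using L c by (intro mult_right_mono) auto
        also note nb
        finally have "K * (r\<^sup>2 / delta\<^sup>2) \<le> real n powr (2 * beta + 2 * p + 1) / (2 * c)"
          using c by (simp add: field_simps)
        also have "\<dots> = real n powr (2 * beta + 2 * p + 2 * alpha * p) * (real n powr c / (2 * c))"
        proof -
          have "2 * beta + 2 * p + 1 = (2 * beta + 2 * p + 2 * alpha * p) + c" by (simp add: c_def)
          hence "real n powr (2 * beta + 2 * p + 1)
              = real n powr (2 * beta + 2 * p + 2 * alpha * p) * real n powr c"
            by (simp only: powr_add)
          thus ?thesis by simp
        qed
        also have "\<dots> \<le> real n powr (2 * beta + 2 * p + 2 * alpha * p)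
            * (\<Sum>i=1..n. real i powr (- (2 * alpha * p)))"
          by (intro mult_left_mono S) auto
        finally show ?thesis .
      qed
      thus "\<forall>\<^sub>F delta in at_right 0. \<forall>n. max 1 (2 powr (1 / c)) \<le> real n \<longrightarrow>
          L * (c * (r\<^sup>2 / delta\<^sup>2)) \<le> real n powr (2 * beta + 2 * p + 1) \<longrightarrow>
          K * (r\<^sup>2 / delta\<^sup>2) \<le> real n powr (2 * beta + 2 * p + 2 * alpha * p)
            * (\<Sum>i=1..n. real i powr (- (2 * alpha * p)))"
        by (intro always_eventually) blast
    qed simp
  next
    case 2
    define b where "b = 2 * beta + 2 * p + 1"
    have b: "1 \<le> b" using beta p by (simp add: b_def)
    have exps: "2 * alpha * p = 1" using 2 by simp
    show ?thesis
    proof (rule that[of b "\<lambda>delta. r\<^sup>2 / delta\<^sup>2 / ln (r\<^sup>2 / delta\<^sup>2)" 1])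
      show "filterlim (\<lambda>delta. r\<^sup>2 / delta\<^sup>2 / ln (r\<^sup>2 / delta\<^sup>2)) at_top (at_right 0)"
        using r by real_asymp
      show "\<forall>\<^sub>F delta in at_right 0. r\<^sup>2 / delta\<^sup>2 / ln (r\<^sup>2 / delta\<^sup>2) \<le> r\<^sup>2 / delta\<^sup>2"
        using r by real_asymp
      show "rate beta r p alpha delta
          = r\<^sup>2 * (1 / (r\<^sup>2 / delta\<^sup>2 / ln (r\<^sup>2 / delta\<^sup>2))) powr (2 * beta / b)" for delta
        using 2 by (simp add: rate_def b_def mult_ac)
      have "\<forall>\<^sub>F delta in at_right 0. 0 < ln (r\<^sup>2 / delta\<^sup>2)"
        using r by real_asymp
      moreover have "\<forall>\<^sub>F delta in at_right 0. 0 < r\<^sup>2 / delta\<^sup>2"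
        using r by real_asymp
      moreover have "\<forall>\<^sub>F delta in at_right 0.
          ln (r\<^sup>2 / delta\<^sup>2) / 2 \<le> ln (r\<^sup>2 / delta\<^sup>2 / ln (r\<^sup>2 / delta\<^sup>2))"
        using r by real_asymp
      ultimately show "\<forall>\<^sub>F delta in at_right 0. \<forall>n. 1 \<le> real n \<longrightarrow>
          L * (r\<^sup>2 / delta\<^sup>2 / ln (r\<^sup>2 / delta\<^sup>2)) \<le> real n powr b \<longrightarrow>
          K * (r\<^sup>2 / delta\<^sup>2) \<le> real n powr (2 * beta + 2 * p + 2 * alpha * p)
            * (\<Sum>i=1..n. real i powr (- (2 * alpha * p)))"
      proof (eventually_elim, intro allI impI)
        fix delta :: real and n :: nat
        assume "0 < ln (r\<^sup>2 / delta\<^sup>2)" "0 < r\<^sup>2 / delta\<^sup>2"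
          "ln (r\<^sup>2 / delta\<^sup>2) / 2 \<le> ln (r\<^sup>2 / delta\<^sup>2 / ln (r\<^sup>2 / delta\<^sup>2))"
          and n: "1 \<le> real n" and "L * (r\<^sup>2 / delta\<^sup>2 / ln (r\<^sup>2 / delta\<^sup>2)) \<le> real n powr b"
        moreover define X where "X = r\<^sup>2 / delta\<^sup>2"
        ultimately have X: "0 < ln X" "0 < X" "ln X / 2 \<le> ln (X / ln X)"
          and nb: "L * (X / ln X) \<le> real n powr b"
          by simp_all
        have Lb: "2 * K * b \<le> L" using L_crit 2 by (simp add: b_def)
        have S: "ln (real n) \<le> (\<Sum>i=1..n. real i powr (- (2 * alpha * p)))"
        proof -
          have "ln (real n) \<le> ln (real n + 1)" using n by simp
          also have "\<dots> \<le> harm n" by (rule ln_le_harm)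
          also have "harm n = (\<Sum>i=1..n. real i powr (- (2 * alpha * p)))"
            unfolding harm_def exps by (intro sum.cong) (auto simp: powr_minus)
          finally show ?thesis .
        qed
        \<comment> \<open>Because \<open>n\<close> is at least a power \<open>1 / b\<close> of \<open>X / ln X\<close>, which is at least \<open>sqrt X\<close>.\<close>
        have ln_n: "ln X \<le> 2 * b * ln (real n)"
        proof -
          have "1 \<le> L" using K L by simp
          have "X / ln X \<le> L * (X / ln X)"
            using X \<open>1 \<le> L\<close> mult_right_mono[of 1 L "X / ln X"] by simp
          hence "ln (X / ln X) \<le> ln (real n powr b)"
            using n nb X by (subst ln_le_cancel_iff) auto
          thus ?thesis using X(3) by simp
        qed
        have "K * X = 2 * K * b * (X / ln X) * (ln X / (2 * b))"
          using X b by simp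
        also have "\<dots> \<le> L * (X / ln X) * (ln X / (2 * b))"
          using X b Lb by (intro mult_right_mono) auto
        also have "\<dots> \<le> real n powr b * (ln X / (2 * b))"
          using X b nb by (intro mult_right_mono) auto
        also have "\<dots> \<le> real n powr b * ln (real n)"
          using ln_n b by (intro mult_left_mono) (auto simp: field_simps)
        also have "\<dots> \<le> real n powr b * (\<Sum>i=1..n. real i powr (- (2 * alpha * p)))"
          by (intro mult_left_mono S) auto
        finally show "K * (r\<^sup>2 / delta\<^sup>2) \<le> real n powr (2 * beta + 2 * p + 2 * alpha * p)
            * (\<Sum>i=1..n. real i powr (- (2 * alpha * p)))"
          by (simp only: X_def b_def exps)
      qed
    qed (simp add: b_def)
  next
    case 3
    define b where "b = 2 * beta + 2 * p + 2 * alpha * p"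
    show ?thesis
    proof (rule that[of b "\<lambda>delta. r\<^sup>2 / delta\<^sup>2" 1])
      show "2 * beta + 2 * p + 1 \<le> b" using 3 by (simp add: b_def)
      show "rate beta r p alpha delta = r\<^sup>2 * (1 / (r\<^sup>2 / delta\<^sup>2)) powr (2 * beta / b)" for delta
        using 3 by (simp add: rate_def b_def)
      have "K * (r\<^sup>2 / delta\<^sup>2) \<le> real n powr b * (\<Sum>i=1..n. real i powr (- (2 * alpha * p)))"
        if n: "1 \<le> real n" and nb: "L * (r\<^sup>2 / delta\<^sup>2) \<le> real n powr b" for n delta
      proof -
        have "(\<Sum>i\<in>{1}. real i powr (- (2 * alpha * p))) \<le> (\<Sum>i=1..n. real i powr (- (2 * alpha * p)))"
          using n by (intro sum_mono2) auto
        hence S: "1 \<le> (\<Sum>i=1..n. real i powr (- (2 * alpha * p)))" by simp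
        have "K * (r\<^sup>2 / delta\<^sup>2) \<le> L * (r\<^sup>2 / delta\<^sup>2)"
          using K L by (intro mult_right_mono) auto
        also note nb
        also have "real n powr b \<le> real n powr b * (\<Sum>i=1..n. real i powr (- (2 * alpha * p)))"
          using mult_left_mono[OF S, of "real n powr b"] by simp
        finally show ?thesis .
      qed
      thus "\<forall>\<^sub>F delta in at_right 0. \<forall>n. 1 \<le> real n \<longrightarrow> L * (r\<^sup>2 / delta\<^sup>2) \<le> real n powr b \<longrightarrow>
          K * (r\<^sup>2 / delta\<^sup>2) \<le> real n powr (2 * beta + 2 * p + 2 * alpha * p)
            * (\<Sum>i=1..n. real i powr (- (2 * alpha * p)))"
        unfolding b_def by (intro always_eventually) blast
    qed (use X_top in auto)
  qed
qed

section \<open>The lower bound\<close>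

theorem proposition4p2:
  fixes p C_A alpha_bar beta_bar :: real
  assumes "p \<ge> 0" and "C_A \<ge> 1" and "alpha_bar > 0"
  shows "\<exists>C_A'>0. \<forall>(alpha::real) (beta::real) (r::real) (D :: real \<Rightarrow> nat).
           0 \<le> alpha \<and> alpha \<le> alpha_bar \<and> 0 \<le> beta \<and>
           (alpha * p = 1 / 2 \<longrightarrow> beta \<le> beta_bar) \<and> 0 < r \<and>
           (\<lambda>delta. minimax_index beta p r delta) \<in> o[at_right 0](\<lambda>delta. real (D delta)) \<longrightarrow>
           (\<forall>\<^sub>F delta in at_right 0.
              \<forall>(M :: 'a measure) (eps :: nat \<Rightarrow> 'a \<Rightarrow> real) (lam :: nat \<Rightarrow> real) (kappa::real).
                std_gaussian_noise M eps (D delta) \<and>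
                singular_values lam (D delta) \<and>
                poly_spectral_decay p C_A lam (D delta) \<and>
                0 < kappa \<and> (\<Sum>i=1..D delta. lam i powr (2 * alpha) * delta\<^sup>2) \<le> kappa \<longrightarrow>
                (SUP mu\<in>sobolev_ellipsoid beta r (D delta).
                   stopped_risk M eps lam (D delta) delta alpha kappa mu)
                  \<ge> ennreal (C_A' * rate beta r p alpha delta))"
proof -
  \<comment> \<open>The power \<open>4 * alpha_bar + 2\<close> of \<open>C_A\<close> collects the loss \<open>2 * alpha + 2\<close> from bounding the
    singular value at the spike and \<open>2 * alpha\<close> from bounding the sum of the weights.\<close>
  define K where "K = 4 * C_A powr (4 * alpha_bar + 2)"
  define L where "L = 2 * K * (2 * \<bar>beta_bar\<bar> + 2 * p + 1)"
  define C where "C = exp (- 4) / 18 * (exp (- 1) / L)"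
  have K: "1 \<le> K"
    using ge_one_powr_ge_zero[of C_A "4 * alpha_bar + 2"] assms by (simp add: K_def)
  have L: "2 * K \<le> L"
    using K assms mult_left_mono[of 1 "2 * \<bar>beta_bar\<bar> + 2 * p + 1" "2 * K"] by (simp add: L_def)
  have C: "0 < C" using K L by (simp add: C_def)
  show ?thesis
  proof (intro exI[of _ C] conjI C allI impI; (elim conjE)?)
    fix alpha beta r :: real and D :: "real \<Rightarrow> nat"
    assume alpha: "0 \<le> alpha" "alpha \<le> alpha_bar" and beta: "0 \<le> beta"
      and crit: "alpha * p = 1 / 2 \<longrightarrow> beta \<le> beta_bar" and r: "0 < r"
      and D: "(\<lambda>delta. minimax_index beta p r delta) \<in> o[at_right 0](\<lambda>delta. real (D delta))"
    have L_crit: "alpha * p = 1 / 2 \<longrightarrow> 2 * K * (2 * beta + 2 * p + 1) \<le> L"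
      unfolding L_def using crit K by (intro impI mult_left_mono) auto
    obtain V b N0 where b: "2 * beta + 2 * p + 1 \<le> b"
      and V: "filterlim V at_top (at_right 0)"
      and VX: "\<forall>\<^sub>F delta in at_right 0. V delta \<le> r\<^sup>2 / delta\<^sup>2"
      and rate: "\<And>delta. rate beta r p alpha delta = r\<^sup>2 * (1 / V delta) powr (2 * beta / b)"
      and spike: "\<forall>\<^sub>F delta in at_right 0. \<forall>n. N0 \<le> real n \<longrightarrow> L * V delta \<le> real n powr b \<longrightarrow>
        K * (r\<^sup>2 / delta\<^sup>2) \<le> real n powr (2 * beta + 2 * p + 2 * alpha * p)
            * (\<Sum>i=1..n. real i powr (- (2 * alpha * p)))"
      by (rule rate_index_asymptotics[OF alpha(1) beta assms(1) r K L L_crit]) (rule that)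
    have "\<forall>\<^sub>F delta in at_right 0. \<exists>n. n \<le> D delta \<and> max N0 (72 * exp 4) \<le> real n \<and>
           L * V delta \<le> real n powr b \<and>
           exp (- 1) / L * (1 / V delta) powr (2 * beta / b) \<le> real n powr (- (2 * beta))"
      using K L by (intro eventually_truncation_index[OF beta assms(1) r b _ V VX D]) simp
    thus "\<forall>\<^sub>F delta in at_right 0.
              \<forall>(M :: 'a measure) (eps :: nat \<Rightarrow> 'a \<Rightarrow> real) (lam :: nat \<Rightarrow> real) (kappa::real).
                std_gaussian_noise M eps (D delta) \<and>
                singular_values lam (D delta) \<and>
                poly_spectral_decay p C_A lam (D delta) \<and>
                0 < kappa \<and> (\<Sum>i=1..D delta. lam i powr (2 * alpha) * delta\<^sup>2) \<le> kappa \<longrightarrow>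
                (SUP mu\<in>sobolev_ellipsoid beta r (D delta).
                   stopped_risk M eps lam (D delta) delta alpha kappa mu)
                  \<ge> ennreal (C * rate beta r p alpha delta)"
      using spike eventually_at_right_less[of 0]
    proof (eventually_elim, intro allI impI, elim conjE)
      fix delta :: real and M :: "'a measure" and eps :: "nat \<Rightarrow> 'a \<Rightarrow> real"
        and lam :: "nat \<Rightarrow> real" and kappa :: real
      assume idx: "\<exists>n. n \<le> D delta \<and> max N0 (72 * exp 4) \<le> real n \<and>
           L * V delta \<le> real n powr b \<and>
           exp (- 1) / L * (1 / V delta) powr (2 * beta / b) \<le> real n powr (- (2 * beta))"
        and sp: "\<forall>n. N0 \<le> real n \<longrightarrow> L * V delta \<le> real n powr b \<longrightarrow>
          K * (r\<^sup>2 / delta\<^sup>2) \<le> real n powr (2 * beta + 2 * p + 2 * alpha * p)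
            * (\<Sum>i=1..n. real i powr (- (2 * alpha * p)))"
        and delta: "0 < delta"
        and model: "std_gaussian_noise M eps (D delta)" "singular_values lam (D delta)"
          "poly_spectral_decay p C_A lam (D delta)"
          "(\<Sum>i=1..D delta. lam i powr (2 * alpha) * delta\<^sup>2) \<le> kappa"
      from idx obtain n where n: "n \<le> D delta" "N0 \<le> real n" "72 * exp 4 \<le> real n"
        "L * V delta \<le> real n powr b"
        "exp (- 1) / L * (1 / V delta) powr (2 * beta / b) \<le> real n powr (- (2 * beta))"
        by auto
      have "4 * C_A powr (4 * alpha + 2) * r\<^sup>2 \<le> K * r\<^sup>2"
        unfolding K_def using assms alpha by (intro mult_right_mono mult_left_mono powr_mono) auto
      also have "\<dots> = delta\<^sup>2 * (K * (r\<^sup>2 / delta\<^sup>2))" using delta by simp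
      also have "\<dots> \<le> delta\<^sup>2 * (real n powr (2 * beta + 2 * p + 2 * alpha * p)
            * (\<Sum>i=1..n. real i powr (- (2 * alpha * p))))"
        using sp n by (intro mult_left_mono) auto
      finally have "4 * C_A powr (4 * alpha + 2) * r\<^sup>2
          \<le> delta\<^sup>2 * real n powr (2 * beta + 2 * p + 2 * alpha * p)
            * (\<Sum>i=1..n. real i powr (- (2 * alpha * p)))"
        by (simp add: mult.assoc)
      note risk = sup_stopped_risk_lower_bound[OF model(1-3) assms(2) alpha(1) model(4) n(1,3) this]
      have "C * rate beta r p alpha delta
          = exp (- 4) / 18 * (r\<^sup>2 * (exp (- 1) / L * (1 / V delta) powr (2 * beta / b)))"
        by (simp add: C_def rate)
      also have "\<dots> \<le> exp (- 4) / 18 * (r\<^sup>2 * real n powr (- (2 * beta)))"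
        using n(5) by (intro mult_left_mono) auto
      finally show "(SUP mu\<in>sobolev_ellipsoid beta r (D delta).
                   stopped_risk M eps lam (D delta) delta alpha kappa mu)
                  \<ge> ennreal (C * rate beta r p alpha delta)"
        by (rule order.trans[OF ennreal_leI risk])
    qed
  qed
qed

end
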